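(* Let $B$ be a connected left regular band, let $G$ be a finite group acting on $B$ by semigroup automorphisms, and let $\mathbf{k}$ be a field with $\mathrm{char}(\mathbf{k})\nmid |G|$. Let $\mathcal{O}\subseteq B$ be a $G$-invariant subset and put $x=\sum_{b\in\mathcal{O}}b\in\mathbf{k} B$. Then the following are equivalent: (1) $x$ generates $(\mathbf{k} B)^G$ as a $\mathbf{k}$-algebra; (2) $|B/G|=|\Lambda(B)/G|$, and for all $X,Y\in\Lambda(B)$, if $|\{b\in\mathcal{O}:\sigma(b)\ge X\}|\equiv|\{b\in\mathcal{O}:\sigma(b)\ge Y\}| \pmod{\mathrm{char}(\mathbf{k})}$ then $[X]=[Y]$. If these equivalent conditions hold, then as algebras $(\mathbf{k} B)^G\cong\mathbf{k}[x]/(m(x))$, where $m(x)=\prod_{[X]\in\Lambda(B)/G}(x-\lambda_{[X]})$ and $\lambda_{[X]}=|\{b\in\mathcal{O}:\sigma(b)\ge X\}|$ (viewed in $\mathbf{k}$).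
   Context: A left regular band (LRB) is a finite semigroup $B$ satisfying $x^2=x$ and $xyx=xy$ for all $x,y\in B$. For $b\in B$ let $\sigma(b)=Bb$; the set $\Lambda(B)$ of principal left ideals ordered by inclusion is the support semilattice. The semigroup order on $B$ is $x\le y$ iff $yx=x$; $B$ is connected if for every $X\in\Lambda(B)$ the Hasse diagram of $B_{\ge X}=\{b:\sigma(b)\ge X\}$ is connected. $G$ acts on $\mathbf{k} B$ linearly and on $\Lambda(B)$ by $g(Bb)=Bg(b)$; $[X]$ denotes the $G$-orbit of $X\in\Lambda(B)$, and $B/G$, $\Lambda(B)/G$ the orbit sets. When $\mathrm{char}(\mathbf{k})=0$, congruence modulo $0$ means equality. *)

theory Defs
  imports
    "HOL-Algebra.Group_Action"
    "HOL-Algebra.Subrings"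
    "HOL-Algebra.Algebraic_Closure_Type"
    "HOL-Number_Theory.Cong"
begin

section \<open>Left regular bands\<close>

class left_regular_band = finite + semigroup_mult +
  assumes band_idem: "x * x = x"
    and left_regular: "x * y * x = x * y"

definition lrb_le :: "'b::left_regular_band \<Rightarrow> 'b \<Rightarrow> bool"
  where "lrb_le x y \<longleftrightarrow> y * x = x"

definition lrb_less :: "'b::left_regular_band \<Rightarrow> 'b \<Rightarrow> bool"
  where "lrb_less x y \<longleftrightarrow> lrb_le x y \<and> x \<noteq> y"

text \<open>The principal left ideal \<open>Bb\<close>.  As \<open>b = b * b\<close>, it contains \<open>b\<close>.\<close>

definition supp :: "'b::left_regular_band \<Rightarrow> 'b set"
  where "supp b = {a * b | a. True}"

text \<open>The support semilattice; its order is inclusion of sets.\<close>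

definition supports :: "'b::left_regular_band set set"
  where "supports = range supp"

definition elts_above :: "'b::left_regular_band set \<Rightarrow> 'b set"
  where "elts_above U = {b. U \<subseteq> supp b}"

text \<open>Covering pairs of the poset induced on \<open>S\<close>.\<close>

definition hasse_edges :: "'b::left_regular_band set \<Rightarrow> ('b \<times> 'b) set"
  where "hasse_edges S =
    {(a, b). a \<in> S \<and> b \<in> S \<and> lrb_less a b \<and> \<not> (\<exists>c\<in>S. lrb_less a c \<and> lrb_less c b)}"

definition hasse_connected :: "'b::left_regular_band set \<Rightarrow> bool"
  where "hasse_connected S \<longleftrightarrow>
    (\<forall>a\<in>S. \<forall>b\<in>S. (a, b) \<in> (hasse_edges S \<union> (hasse_edges S)\<inverse>)\<^sup>*)"

definition connected_lrb :: "'b::left_regular_band itself \<Rightarrow> bool"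
  where "connected_lrb _ \<longleftrightarrow> (\<forall>U\<in>(supports :: 'b set set). hasse_connected (elts_above U))"


section \<open>Algebras over a field\<close>

text \<open>
  An algebra over the field \<open>'k\<close> is a record of type \<^typ>\<open>('k, 'a) module\<close>, with all of \<open>'k\<close> as
  scalars.  Subalgebras, generation and isomorphisms are unital: the HOL-Algebra notions
  \<^const>\<open>subring\<close> and \<^const>\<open>ring_iso\<close> include the unit.
\<close>

definition unital_subalgebra :: "('k::field, 'a, 'm) module_scheme \<Rightarrow> 'a set \<Rightarrow> bool"
  where "unital_subalgebra A S \<longleftrightarrow>
    subring S A \<and> (\<forall>c::'k. \<forall>s\<in>S. c \<odot>\<^bsub>A\<^esub> s \<in> S)"

definition generated_subalgebra :: "('k::field, 'a, 'm) module_scheme \<Rightarrow> 'a set \<Rightarrow> 'a set"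
  where "generated_subalgebra A T = \<Inter>{S. unital_subalgebra A S \<and> T \<subseteq> S}"

definition algebra_isos ::
    "('k::field, 'a, 'm) module_scheme \<Rightarrow> ('k, 'c, 'n) module_scheme \<Rightarrow> ('a \<Rightarrow> 'c) set"
  where "algebra_isos A A' =
    {h \<in> ring_iso A A'. \<forall>c::'k. \<forall>a\<in>carrier A. h (c \<odot>\<^bsub>A\<^esub> a) = c \<odot>\<^bsub>A'\<^esub> h a}"

definition algebras_isomorphic ::
    "('k::field, 'a, 'm) module_scheme \<Rightarrow> ('k, 'c, 'n) module_scheme \<Rightarrow> bool"
  where "algebras_isomorphic A A' \<longleftrightarrow> algebra_isos A A' \<noteq> {}"

text \<open>The quotient ring with \<open>c (I + p) = I + c p\<close>, written in the style of \<^const>\<open>rcoset_mult\<close>.\<close>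

definition quotient_algebra ::
    "('k::field, 'a, 'm) module_scheme \<Rightarrow> 'a set \<Rightarrow> ('k, 'a set) module"
  where "quotient_algebra A I =
    ring.extend (A Quot I) (module.fields (\<lambda>c U. \<Union>p\<in>U. I +>\<^bsub>A\<^esub> (c \<odot>\<^bsub>A\<^esub> p)))"

definition poly_algebra :: "('k::field, 'k poly) module"
  where "poly_algebra = ring.extend ring_of_type_algebra (module.fields Polynomial.smult)"


section \<open>The semigroup algebra and its invariants\<close>

text \<open>
  A finitely supported formal sum is a function \<open>'b \<Rightarrow> 'k\<close>, as \<open>'b\<close> is finite.  The semigroup need
  not have an identity, so the unit is the (unique, if any) two-sided identity of the convolution
  product; it exists whenever the left regular band is connected, but in general it is not a
  basis element.
\<close>

definition convolution ::
    "('b::left_regular_band \<Rightarrow> 'k::field) \<Rightarrow> ('b \<Rightarrow> 'k) \<Rightarrow> 'b \<Rightarrow> 'k"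
  where "convolution f h = (\<lambda>c. \<Sum>(a, b)\<in>{(a, b). a * b = c}. f a * h b)"

definition semigroup_algebra :: "('k::field, 'b::left_regular_band \<Rightarrow> 'k) module"
  where "semigroup_algebra =
    \<lparr>carrier = UNIV,
     monoid.mult = convolution,
     one = (THE e. \<forall>f. convolution e f = f \<and> convolution f e = f),
     ring.zero = (\<lambda>_. 0),
     add = (\<lambda>f h b. f b + h b),
     module.smult = (\<lambda>c f b. c * f b)\<rparr>"

definition basis_elt :: "'b::left_regular_band \<Rightarrow> 'b \<Rightarrow> 'k::field"
  where "basis_elt b = (\<lambda>c. if c = b then 1 else 0)"

definition sum_elt :: "'b::left_regular_band set \<Rightarrow> 'b \<Rightarrow> 'k::field"
  where "sum_elt S = (\<Oplus>\<^bsub>semigroup_algebra\<^esub>b\<in>S. basis_elt b)"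

definition linear_extension ::
    "('b::left_regular_band \<Rightarrow> 'b) \<Rightarrow> ('b \<Rightarrow> 'k::field) \<Rightarrow> 'b \<Rightarrow> 'k"
  where "linear_extension s f =
    (\<Oplus>\<^bsub>semigroup_algebra\<^esub>b\<in>UNIV. f b \<odot>\<^bsub>semigroup_algebra\<^esub> basis_elt (s b))"

definition invariant_algebra ::
    "('g, 'm) monoid_scheme \<Rightarrow> ('g \<Rightarrow> 'b \<Rightarrow> 'b) \<Rightarrow> ('k::field, 'b::left_regular_band \<Rightarrow> 'k) module"
  where "invariant_algebra G \<phi> =
    semigroup_algebra\<lparr>carrier := {f. \<forall>g\<in>carrier G. linear_extension (\<phi> g) f = f}\<rparr>"


section \<open>The action on supports\<close>

text \<open>The image of \<open>Bb\<close> under an automorphism \<open>s\<close> is \<open>B s(b)\<close>, so \<open>G\<close> acts on supports by images.\<close>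

lemma image_supp:
  fixes s :: "'b::left_regular_band \<Rightarrow> 'b"
  assumes "bij s" and "\<And>a b. s (a * b) = s a * s b"
  shows "s ` supp b = supp (s b)"
proof -
  have "supp b = range (\<lambda>a. a * b)" for b :: 'b
    by (auto simp: supp_def)
  moreover have "range (\<lambda>a. s a * s b) = range (\<lambda>a. a * s b)"
    using bij_is_surj[OF assms(1)] image_image[of "\<lambda>a. a * s b" s UNIV] by simp
  ultimately show ?thesis
    by (simp add: image_image assms(2))
qed

definition support_action :: "('g \<Rightarrow> 'b \<Rightarrow> 'b) \<Rightarrow> 'g \<Rightarrow> 'b::left_regular_band set \<Rightarrow> 'b set"
  where "support_action \<phi> g U = \<phi> g ` U"

definition count_above :: "'b::left_regular_band set \<Rightarrow> 'b set \<Rightarrow> nat"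
  where "count_above S U = card {b \<in> S. U \<subseteq> supp b}"

text \<open>
  For an invariant set \<open>S\<close> the function \<^term>\<open>count_above S\<close> is constant on each orbit \<open>C\<close> of
  supports, so \<^term>\<open>the_elem (count_above S ` C)\<close> is its value there.
\<close>

definition eigenvalue_poly ::
    "('g, 'm) monoid_scheme \<Rightarrow> ('g \<Rightarrow> 'b \<Rightarrow> 'b) \<Rightarrow> 'b::left_regular_band set \<Rightarrow> 'k::field poly"
  where "eigenvalue_poly G \<phi> S =
    (\<Prod>C\<in>orbits G supports (support_action \<phi>). [:- of_nat (the_elem (count_above S ` C)), 1:])"

end

theory Submission
  imports Defs
begin

text \<open>
  For \<open>c \<in> B\<close> let \<open>\<chi>\<^sub>c\<close> be the character of \<open>kB\<close> that sums the coefficients of the elements with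
  support above \<open>supp c\<close>.  It depends only on \<open>supp c\<close>, and on invariants only on the orbit of
  \<open>supp c\<close>; moreover \<open>\<chi>\<^sub>c(x) = \<lambda>\<^bsub>[supp c]\<^esub>\<close>.

  An invariant \<open>f\<close> that is killed by all characters and commutes with all invariants vanishes:
  if \<open>c\<close> has maximal support among the basis elements occurring in \<open>f\<close>, and \<open>s\<close> is the sum of the
  \<open>G\<close>-translates of \<open>c\<close>, then comparing the coefficients of \<open>f s\<close> and \<open>s f\<close> at \<open>c\<close> gives
  \<open>f(c) \<chi>\<^sub>c(s) = s(c) \<chi>\<^sub>c(f) = 0\<close>, where \<open>\<chi>\<^sub>c(s)\<close> is the order of a subgroup of \<open>G\<close>.  So if \<open>x\<close>
  generates the invariants, the characters separate them.  On the other hand the characters separate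
  the invariants exactly if \<open>|B/G| = |\<Lambda>(B)/G|\<close>, that is, if elements with the same support lie in
  the same orbit.  The remaining condition says that the values \<open>\<chi>\<^sub>c(x)\<close> distinguish the orbits of
  supports; then Lagrange interpolation expresses every invariant as a polynomial in \<open>x\<close>, and the
  polynomials annihilating \<open>x\<close> are the multiples of \<open>m\<close>.
\<close>

section \<open>Polynomials\<close>

text \<open>Newton interpolation, one node at a time: a multiple of a polynomial vanishing at the
  earlier nodes corrects the value at the new one. Nodes may repeat if the values agree, so no
  representatives of orbits need be chosen later.\<close>

lemma interpolation_poly:
  fixes l v :: "'i \<Rightarrow> 'k::field"
  assumes "finite I" "\<And>i j. i \<in> I \<Longrightarrow> j \<in> I \<Longrightarrow> l i = l j \<Longrightarrow> v i = v j"
  shows "\<exists>p. \<forall>i\<in>I. poly p (l i) = v i"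
  using assms
proof (induction I)
  case (insert j I)
  then obtain p where p: "\<forall>i\<in>I. poly p (l i) = v i" by blast
  show ?case
  proof (cases "l j \<in> l ` I")
    case True
    then obtain i where "i \<in> I" "l j = l i" by blast
    then have "poly p (l j) = v j" using p insert.prems[of i j] by auto
    then show ?thesis using p by blast
  next
    case False
    define q where "q = (\<Prod>i\<in>I. [:- l i, 1:])"
    have q: "poly q (l i) = 0" if "i \<in> I" for i
      using that insert.hyps by (auto simp: q_def poly_prod)
    have "poly q (l j) \<noteq> 0"
      using False insert.hyps by (auto simp: q_def poly_prod)
    then have "\<forall>i\<in>insert j I.
          poly (p + Polynomial.smult ((v j - poly p (l j)) / poly q (l j)) q) (l i) = v i"
      using p q by auto
    then show ?thesis by blast
  qed
qed auto

text \<open>Split off the linear factor of one root; as the roots are distinct, the cofactor still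
  vanishes at all the others.\<close>

lemma prod_linear_dvd_iff:
  fixes l :: "'i \<Rightarrow> 'k::field"
  assumes "finite I" "inj_on l I"
  shows "(\<Prod>i\<in>I. [:- l i, 1:]) dvd p \<longleftrightarrow> (\<forall>i\<in>I. poly p (l i) = 0)"
  using assms
proof (induction I arbitrary: p)
  case (insert j I)
  show ?case
  proof
    assume "(\<Prod>i\<in>insert j I. [:- l i, 1:]) dvd p"
    then show "\<forall>i\<in>insert j I. poly p (l i) = 0"
      using insert.hyps by (auto simp: dvd_def poly_prod)
  next
    assume p: "\<forall>i\<in>insert j I. poly p (l i) = 0"
    then obtain q where q: "p = [:- l j, 1:] * q"
      using poly_eq_0_iff_dvd[of p "l j"] by (auto simp: dvd_def)
    have "poly q (l i) = 0" if "i \<in> I" for i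
      using p that insert.hyps insert.prems by (auto simp: q inj_on_def)
    then have "(\<Prod>i\<in>I. [:- l i, 1:]) dvd q"
      using insert by simp
    then show "(\<Prod>i\<in>insert j I. [:- l i, 1:]) dvd p"
      using insert.hyps by (simp add: q mult_dvd_mono del: mult_pCons_left)
  qed
qed auto

section \<open>Polynomial evaluation in an algebra over a field\<close>

lemma poly_algebra_simps [simp]:
  "carrier (poly_algebra :: ('k::field, 'k poly) module) = UNIV"
  "p \<otimes>\<^bsub>poly_algebra\<^esub> q = p * q"
  "\<one>\<^bsub>poly_algebra\<^esub> = 1"
  "p \<oplus>\<^bsub>poly_algebra\<^esub> q = p + q"
  "c \<odot>\<^bsub>poly_algebra\<^esub> p = Polynomial.smult c p"
  for p q :: "'k::field poly" and c :: 'k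
  by (simp_all add: poly_algebra_def ring_of_type_algebra_def ring.defs module.defs)

text \<open>Commutativity is not assumed, since invariants need not commute.\<close>

locale unital_algebra = ring A for A :: "('k::field, 'a, 'm) module_scheme" (structure) +
  assumes smult_closed [simp, intro]: "a \<in> carrier A \<Longrightarrow> c \<odot> a \<in> carrier A"
    and smult_l_distr: "a \<in> carrier A \<Longrightarrow> (c + d) \<odot> a = c \<odot> a \<oplus> d \<odot> a"
    and smult_r_distr: "a \<in> carrier A \<Longrightarrow> b \<in> carrier A \<Longrightarrow> c \<odot> (a \<oplus> b) = c \<odot> a \<oplus> c \<odot> b"
    and smult_smult: "a \<in> carrier A \<Longrightarrow> c \<odot> (d \<odot> a) = (c * d) \<odot> a"
    and smult_one [simp]: "a \<in> carrier A \<Longrightarrow> 1 \<odot> a = a"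
    and smult_mult_left: "a \<in> carrier A \<Longrightarrow> b \<in> carrier A \<Longrightarrow> (c \<odot> a) \<otimes> b = c \<odot> (a \<otimes> b)"
    and smult_mult_right: "a \<in> carrier A \<Longrightarrow> b \<in> carrier A \<Longrightarrow> a \<otimes> (c \<odot> b) = c \<odot> (a \<otimes> b)"
begin

lemma smult_zero_left [simp]:
  assumes "a \<in> carrier A" shows "0 \<odot> a = \<zero>"
  using smult_l_distr[of a 0 0] assms by (simp add: add.l_cancel_one')

lemma smult_zero_right [simp]: "c \<odot> \<zero> = \<zero>"
  using smult_r_distr[of \<zero> \<zero> c] by (simp add: add.l_cancel_one')

lemma smult_minus_one:
  assumes "a \<in> carrier A" shows "(- 1) \<odot> a = \<ominus> a"
proof -
  have "(- 1) \<odot> a \<oplus> a = \<zero>"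
    using smult_l_distr[of a "- 1" 1] assms by simp
  then show ?thesis using assms by (simp add: minus_equality)
qed

text \<open>Horner's scheme, which avoids powers and finite sums in \<open>A\<close> and makes
  induction over \<open>pCons\<close> immediate.\<close>

definition poly_eval :: "'a \<Rightarrow> 'k poly \<Rightarrow> 'a" where
  "poly_eval x p = fold_coeffs (\<lambda>a r. a \<odot> \<one> \<oplus> x \<otimes> r) p \<zero>"

lemma poly_eval_0 [simp]: "poly_eval x 0 = \<zero>"
  by (simp add: poly_eval_def)

context
  fixes x assumes x [simp]: "x \<in> carrier A"
begin

lemma poly_eval_pCons [simp]: "poly_eval x (pCons a p) = a \<odot> \<one> \<oplus> x \<otimes> poly_eval x p"
  \<comment> \<open>If both are zero, \<open>pCons a p\<close> is the zero polynomial, on which the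
    fold takes no step.\<close>
  by (cases "a = 0 \<and> p = 0") (auto simp: poly_eval_def)

lemma poly_eval_closed [simp, intro]: "poly_eval x p \<in> carrier A"
  by (induction p) auto

lemma poly_eval_1 [simp]: "poly_eval x 1 = \<one>"
  by (simp add: one_pCons)

lemma poly_eval_X [simp]: "poly_eval x [:0, 1:] = x"
  by simp

lemma poly_eval_add: "poly_eval x (p + q) = poly_eval x p \<oplus> poly_eval x q"
  by (induction p q rule: poly_induct2) (simp_all add: smult_l_distr r_distr a_ac)

lemma poly_eval_smult: "poly_eval x (Polynomial.smult c p) = c \<odot> poly_eval x p"
  by (induction p) (simp_all add: smult_r_distr smult_smult smult_mult_right)

lemma poly_eval_minus: "poly_eval x (- p) = \<ominus> poly_eval x p"
  using poly_eval_smult[of "- 1" p] by (simp add: smult_minus_one)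

lemma poly_eval_mult: "poly_eval x (p * q) = poly_eval x p \<otimes> poly_eval x q"
  by (induction p)
    (simp_all add: poly_eval_add poly_eval_smult l_distr smult_mult_left m_assoc)

lemma poly_eval_commute: "poly_eval x p \<otimes> poly_eval x q = poly_eval x q \<otimes> poly_eval x p"
  by (simp flip: poly_eval_mult add: mult.commute)

text \<open>The values of polynomials at \<open>x\<close> form a subalgebra containing
  \<open>x\<close>; conversely, Horner's scheme only uses operations under which every subalgebra is
  closed.\<close>

lemma generated_subalgebra_singleton: "generated_subalgebra A {x} = range (poly_eval x)"
proof
  have "subring (range (poly_eval x)) A"
    by (rule subringI)
      (auto simp flip: poly_eval_minus poly_eval_mult poly_eval_add poly_eval_1)
  moreover have "c \<odot> s \<in> range (poly_eval x)" if "s \<in> range (poly_eval x)" for c s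
    using that by (auto simp flip: poly_eval_smult)
  moreover have "x \<in> range (poly_eval x)"
    using poly_eval_X by (metis rangeI)
  ultimately show "generated_subalgebra A {x} \<subseteq> range (poly_eval x)"
    by (auto simp: generated_subalgebra_def unital_subalgebra_def)
  have "poly_eval x p \<in> S" if "unital_subalgebra A S" "x \<in> S" for S p
  proof -
    note S = subringE[of S A]
    show ?thesis using that
      by (induction p) (auto simp: unital_subalgebra_def intro!: S)
  qed
  then show "range (poly_eval x) \<subseteq> generated_subalgebra A {x}"
    by (auto simp: generated_subalgebra_def)
qed

text \<open>The isomorphism is constructed from \<open>A\<close> to the quotient, where no choice of
  representatives arises: it sends \<open>a\<close> to the fibre \<open>h a\<close> of evaluation
  over \<open>a\<close>, which is a coset of the ideal.\<close>

theorem quotient_algebra_isomorphic: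
  assumes surj: "range (poly_eval x) = carrier A"
    and kernel: "\<And>p. poly_eval x p = \<zero> \<longleftrightarrow> m dvd p"
  shows "algebras_isomorphic A (quotient_algebra poly_algebra (PIdl\<^bsub>poly_algebra\<^esub> m))"
proof -
  define I where "I = PIdl\<^bsub>poly_algebra\<^esub> m"
  define h where "h a = {p. poly_eval x p = a}" for a
  have I: "I = {p. m dvd p}"
    by (auto simp: I_def cgenideal_def dvd_def mult.commute)
  have coset: "I +>\<^bsub>poly_algebra\<^esub> p = h (poly_eval x p)" for p
  proof -
    have "I +>\<^bsub>poly_algebra\<^esub> p = {q. m dvd q - p}"
      unfolding a_r_coset_def' I
      by (auto simp: algebra_simps intro: exI[of _ "_ - p"])
    also have "\<dots> = {q. poly_eval x (q + - p) = \<zero>}"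
      by (simp add: kernel)
    also have "\<dots> = h (poly_eval x p)"
      unfolding h_def poly_eval_add poly_eval_minus
      by (auto simp flip: minus_eq)
    finally show ?thesis .
  qed
  have ex: "\<exists>p. a = poly_eval x p" if "a \<in> carrier A" for a
    using that surj by auto
  have carrier: "carrier (quotient_algebra poly_algebra I) = h ` carrier A"
    unfolding quotient_algebra_def FactRing_def ring.defs A_RCOSETS_def'
    by (auto simp: coset surj[symmetric])
  have mult: "h (a \<otimes> b) = h a \<otimes>\<^bsub>quotient_algebra poly_algebra I\<^esub> h b"
    if "a \<in> carrier A" "b \<in> carrier A" for a b
  proof -
    have "h a \<otimes>\<^bsub>quotient_algebra poly_algebra I\<^esub> h b = (\<Union>p\<in>h a. \<Union>q\<in>h b. h (poly_eval x (p * q)))"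
      by (simp add: quotient_algebra_def FactRing_def ring.defs rcoset_mult_def coset)
    \<comment> \<open>All members of the union are the same fibre, and the index sets are nonempty
      because evaluation is surjective.\<close>
    also have "\<dots> = h (a \<otimes> b)"
      using ex[OF that(1)] ex[OF that(2)] by (auto simp: h_def poly_eval_mult)
    finally show ?thesis by simp
  qed
  have add: "h (a \<oplus> b) = h a \<oplus>\<^bsub>quotient_algebra poly_algebra I\<^esub> h b"
    if ab: "a \<in> carrier A" "b \<in> carrier A" for a b
  proof -
    have "h a \<oplus>\<^bsub>quotient_algebra poly_algebra I\<^esub> h b = {p + q |p q. p \<in> h a \<and> q \<in> h b}"
      unfolding quotient_algebra_def FactRing_def ring.defs set_add_def'
      by (auto simp: set_add_def')
    also have "\<dots> = h (a \<oplus> b)"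
    proof (intro equalityI subsetI)
      fix r assume r: "r \<in> h (a \<oplus> b)"
      \<comment> \<open>Any \<open>p\<close> over \<open>a\<close> can be split off: the remainder
        \<open>r - p\<close> then lies over \<open>b\<close>.\<close>
      obtain p where p: "a = poly_eval x p" using ex[OF ab(1)] by auto
      have "poly_eval x (r + - p) = b"
        unfolding poly_eval_add poly_eval_minus using r p ab
        by (simp add: h_def) (metis a_comm local.add.m_assoc r_neg1 poly_eval_closed add.inv_closed)
      then have "p \<in> h a" "r - p \<in> h b" "r = p + (r - p)"
        by (simp_all add: h_def p)
      then show "r \<in> {p + q |p q. p \<in> h a \<and> q \<in> h b}" by blast
    qed (auto simp: h_def poly_eval_add)
    finally show ?thesis by simp
  qed
  have one: "h \<one> = \<one>\<^bsub>quotient_algebra poly_algebra I\<^esub>"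
    by (simp add: quotient_algebra_def FactRing_def ring.defs coset)
  have smult: "h (c \<odot> a) = c \<odot>\<^bsub>quotient_algebra poly_algebra I\<^esub> h a"
    if "a \<in> carrier A" for c a
  proof -
    have "c \<odot>\<^bsub>quotient_algebra poly_algebra I\<^esub> h a
      = (\<Union>p\<in>h a. h (poly_eval x (Polynomial.smult c p)))"
      by (simp add: quotient_algebra_def ring.defs module.defs coset)
    also have "\<dots> = h (c \<odot> a)"
      using ex[OF that] by (auto simp: h_def poly_eval_smult)
    finally show ?thesis by simp
  qed
  have "inj_on h (carrier A)"
    using ex by (force simp: inj_on_def h_def)
  then have "h \<in> algebra_isos A (quotient_algebra poly_algebra I)"
    unfolding algebra_isos_def using carrier mult add one smult
    by (auto intro!: ring_iso_memI simp: bij_betw_def)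
  then show ?thesis
    unfolding algebras_isomorphic_def I_def by blast
qed

end

end

section \<open>Convolution and the identity of the semigroup algebra\<close>

lemma mem_supp_iff: "a \<in> supp b \<longleftrightarrow> a * b = a"
proof
  assume "a \<in> supp b"
  then obtain c where "a = c * b" by (auto simp: supp_def)
  then show "a * b = a" by (simp add: mult.assoc band_idem)
next
  assume "a * b = a"
  then have "a = a * b" by simp
  then show "a \<in> supp b" unfolding supp_def by blast
qed

lemma supp_subset_iff: "supp a \<subseteq> supp b \<longleftrightarrow> a * b = a"
proof
  assume "supp a \<subseteq> supp b"
  moreover have "a \<in> supp a" by (simp add: mem_supp_iff band_idem)
  ultimately show "a * b = a" by (auto simp: mem_supp_iff)
next
  assume ab: "a * b = a"
  have "c * b = c" if "c * a = c" for c
    using that ab by (metis mult.assoc)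
  then show "supp a \<subseteq> supp b" by (auto simp: mem_supp_iff)
qed

lemma supp_eq_iff: "supp a = supp b \<longleftrightarrow> a * b = a \<and> b * a = b"
  by (simp add: set_eq_subset supp_subset_iff)

text \<open>Automorphisms preserve the size of supports, so this turns inclusions between supports
  of translates into equalities.\<close>

lemma supp_eq_if_card:
  assumes "a * b = a" "card (supp b) \<le> card (supp a)"
  shows "supp b = supp a"
  using assms card_seteq[of "supp b" "supp a"] by (simp add: supp_subset_iff)

lemma left_regular': "a * (b * a) = a * b" for a :: "'b::left_regular_band"
  using left_regular[of a b] by (simp add: mult.assoc)

text \<open>In other words, \<open>supp (a * b)\<close> is the meet of \<open>supp a\<close> and
  \<open>supp b\<close>; this makes the characters multiplicative.\<close>

lemma supp_subset_mult_iff: "c * (a * b) = c \<longleftrightarrow> c * a = c \<and> c * b = c"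
  for c :: "'b::left_regular_band"
proof
  assume c: "c * (a * b) = c"
  have "c * (a * b) * a = c * (a * b)" "c * (a * b) * b = c * (a * b)"
    by (simp_all add: mult.assoc left_regular' band_idem)
  then show "c * a = c \<and> c * b = c"
    using c by simp
qed (metis mult.assoc)

section \<open>Calculus of convolutions\<close>

lemma sum_convolution:
  "(\<Sum>c\<in>UNIV. convolution f h c * F c) = (\<Sum>a\<in>UNIV. \<Sum>b\<in>UNIV. f a * h b * F (a * b))"
proof -
  have "(\<Sum>c\<in>UNIV. convolution f h c * F c)
    = (\<Sum>c\<in>UNIV. \<Sum>p\<in>{p\<in>UNIV. fst p * snd p = c}. f (fst p) * h (snd p) * F (fst p * snd p))"
    by (auto simp: convolution_def sum_distrib_right case_prod_unfold intro!: sum.cong)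
  also have "\<dots> = (\<Sum>p\<in>UNIV. f (fst p) * h (snd p) * F (fst p * snd p))"
    by (rule sum.group) auto
  also have "\<dots> = (\<Sum>a\<in>UNIV. \<Sum>b\<in>UNIV. f a * h b * F (a * b))"
    by (simp add: sum.cartesian_product case_prod_unfold flip: UNIV_Times_UNIV)
  finally show ?thesis .
qed

lemma sum_basis_elt [simp]:
  "(\<Sum>b\<in>UNIV. f b * basis_elt a b) = f a" "(\<Sum>b\<in>UNIV. f b * basis_elt b a) = f a"
  "(\<Sum>b\<in>UNIV. basis_elt a b * f b) = f a" "(\<Sum>b\<in>UNIV. basis_elt b a * f b) = f a"
  by (simp_all add: basis_elt_def mult_delta_left mult_delta_right)

lemma convolution_apply:
  "convolution f h c = (\<Sum>a\<in>UNIV. \<Sum>b\<in>UNIV. f a * h b * basis_elt c (a * b))"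
  using sum_convolution[of f h "basis_elt c"] by simp

text \<open>Pairing with test functions \<open>F\<close> allows \<open>sum_convolution\<close> to
  replace constrained sums by free double sums, so that identities between convolutions become
  rearrangements.\<close>

lemma eqI_sum:
  fixes f h :: "'b::left_regular_band \<Rightarrow> 'k::field"
  assumes "\<And>F :: 'b \<Rightarrow> 'k. (\<Sum>c\<in>UNIV. f c * F c) = (\<Sum>c\<in>UNIV. h c * F c)"
  shows "f = h"
proof
  show "f c = h c" for c
    using assms[of "basis_elt c"] by simp
qed

lemma convolution_assoc: "convolution (convolution f h) k = convolution f (convolution h k)"
proof (rule eqI_sum)
  fix F
  have 1: "(\<Sum>b\<in>UNIV. f a * convolution h k b * F (a * b))
      = (\<Sum>b\<in>UNIV. \<Sum>c\<in>UNIV. f a * h b * k c * F (a * b * c))" for a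
    using sum_convolution[of h k "\<lambda>b. f a * F (a * b)"]
    by (simp add: algebra_simps)
  have 2: "(\<Sum>d\<in>UNIV. \<Sum>c\<in>UNIV. convolution f h d * k c * F (d * c))
      = (\<Sum>a\<in>UNIV. \<Sum>b\<in>UNIV. \<Sum>c\<in>UNIV. f a * h b * k c * F (a * b * c))"
    using sum_convolution[of f h "\<lambda>d. \<Sum>c\<in>UNIV. k c * F (d * c)"]
    by (simp add: algebra_simps sum_distrib_left)
  show "(\<Sum>c\<in>UNIV. convolution (convolution f h) k c * F c)
      = (\<Sum>c\<in>UNIV. convolution f (convolution h k) c * F c)"
    by (simp add: sum_convolution 1 2)
qed

lemma convolution_basis_elt_right:
  "convolution f (basis_elt b) c = (\<Sum>a\<in>UNIV. if a * b = c then f a else 0)"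
proof -
  have "convolution f (basis_elt b) c
      = (\<Sum>a\<in>UNIV. \<Sum>d\<in>UNIV. (f a * basis_elt c (a * d)) * basis_elt b d)"
    by (simp only: convolution_apply mult_ac)
  also have "\<dots> = (\<Sum>a\<in>UNIV. if a * b = c then f a else 0)"
    by (simp only: sum_basis_elt) (auto simp: basis_elt_def intro: sum.cong)
  finally show ?thesis .
qed

lemma convolution_basis_elt_left:
  "convolution (basis_elt a) f c = (\<Sum>b\<in>UNIV. if a * b = c then f b else 0)"
proof -
  have "convolution (basis_elt a) f c
      = (\<Sum>b\<in>UNIV. \<Sum>d\<in>UNIV. (f b * basis_elt c (d * b)) * basis_elt a d)"
    unfolding convolution_apply by (subst sum.swap) (simp only: mult_ac)
  also have "\<dots> = (\<Sum>b\<in>UNIV. if a * b = c then f b else 0)"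
    by (simp only: sum_basis_elt) (auto simp: basis_elt_def intro: sum.cong)
  finally show ?thesis .
qed

lemma convolution_basis_elt: "convolution (basis_elt a) (basis_elt b) = basis_elt (a * b)"
proof
  fix c
  have "convolution (basis_elt a) (basis_elt b) c
      = (\<Sum>d\<in>UNIV. (if d * b = c then 1 else 0) * basis_elt a d)"
    unfolding convolution_basis_elt_right by (rule sum.cong) auto
  then show "convolution (basis_elt a) (basis_elt b) c = basis_elt (a * b) c"
    by (simp only: sum_basis_elt) (simp add: basis_elt_def eq_commute)
qed

lemma convolution_expand_left: "convolution f h c = (\<Sum>a\<in>UNIV. f a * convolution (basis_elt a) h c)"
  unfolding convolution_basis_elt_left unfolding convolution_apply sum_distrib_left
  by (intro sum.cong) (auto simp: basis_elt_def)

lemma convolution_expand_right: "convolution f h c = (\<Sum>b\<in>UNIV. h b * convolution f (basis_elt b) c)"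
  unfolding convolution_basis_elt_right unfolding convolution_apply sum_distrib_left
  by (subst sum.swap, intro sum.cong) (auto simp: basis_elt_def)

lemma convolution_add_left:
  "convolution (\<lambda>c. f c + h c) k = (\<lambda>c. convolution f k c + convolution h k c)"
  by (simp add: fun_eq_iff convolution_apply distrib_right sum.distrib)

lemma convolution_add_right:
  "convolution k (\<lambda>c. f c + h c) = (\<lambda>c. convolution k f c + convolution k h c)"
  by (simp add: fun_eq_iff convolution_apply distrib_left distrib_right sum.distrib)

lemma convolution_smult_left: "convolution (\<lambda>c. t * f c) k = (\<lambda>c. t * convolution f k c)"
  by (simp add: fun_eq_iff convolution_apply sum_distrib_left mult.assoc)

lemma convolution_smult_right: "convolution k (\<lambda>c. t * f c) = (\<lambda>c. t * convolution k f c)"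
  by (simp add: fun_eq_iff convolution_apply sum_distrib_left mult_ac)

lemma convolution_diff_left:
  "convolution (\<lambda>c. f c - h c) k = (\<lambda>c. convolution f k c - convolution h k c)"
  by (simp add: fun_eq_iff convolution_apply left_diff_distrib sum_subtractf)

lemma convolution_diff_right:
  "convolution k (\<lambda>c. f c - h c) = (\<lambda>c. convolution k f c - convolution k h c)"
  by (simp add: fun_eq_iff convolution_apply left_diff_distrib right_diff_distrib sum_subtractf)

text \<open>The left regular law, extended linearly in the middle factor.\<close>

lemma basis_elt_sandwich:
  "convolution (basis_elt b) (convolution f (basis_elt b)) = convolution (basis_elt b) f"
proof (rule eqI_sum)
  fix F
  have left: "(\<Sum>c\<in>UNIV. convolution (basis_elt b) h c * F c) = (\<Sum>d\<in>UNIV. h d * F (b * d))" for h F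
  proof -
    have "(\<Sum>c\<in>UNIV. convolution (basis_elt b) h c * F c)
        = (\<Sum>d\<in>UNIV. \<Sum>a\<in>UNIV. (h d * F (a * d)) * basis_elt b a)"
      by (subst sum_convolution, subst sum.swap) (simp only: mult_ac)
    then show ?thesis by (simp only: sum_basis_elt)
  qed
  have "(\<Sum>c\<in>UNIV. convolution f (basis_elt b) c * F (b * c))
      = (\<Sum>a\<in>UNIV. \<Sum>d\<in>UNIV. (f a * F (b * (a * d))) * basis_elt b d)"
    by (subst sum_convolution) (simp only: mult_ac)
  then have "(\<Sum>c\<in>UNIV. convolution f (basis_elt b) c * F (b * c)) = (\<Sum>a\<in>UNIV. f a * F (b * a))"
    by (simp only: sum_basis_elt left_regular')
  then show "(\<Sum>c\<in>UNIV. convolution (basis_elt b) (convolution f (basis_elt b)) c * F c)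
      = (\<Sum>c\<in>UNIV. convolution (basis_elt b) f c * F c)"
    by (simp only: left)
qed

text \<open>The identity is \<open>1 - (\<Prod>c. 1 - c)\<close>: multiplying by \<open>b\<close> from the left kills the product,
  as \<open>b w (1 - b) = 0\<close> for all \<open>w\<close>.\<close>

lemma right_identity_exists:
  "\<exists>r :: 'b::left_regular_band \<Rightarrow> 'k::field. \<forall>f. convolution f r = f"
proof -
  have "\<exists>r :: 'b \<Rightarrow> 'k. \<forall>b\<in>A. convolution (basis_elt b) r = basis_elt b"
    if "finite A" for A :: "'b set"
    using that
  proof induction
    case (insert c A)
    then obtain r :: "'b \<Rightarrow> 'k" where r: "\<forall>b\<in>A. convolution (basis_elt b) r = basis_elt b" by blast
    \<comment> \<open>Formally \<open>1 - ?r = (1 - r)(1 - c)\<close>. Multiplied from the left by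
      \<open>b\<close> in \<open>A\<close>, the last two terms cancel because
      \<open>b r = b\<close>; for \<open>b = c\<close>, the first and the last cancel because
      \<open>c r c = c r\<close>.\<close>
    let ?r = "\<lambda>d. (r d + basis_elt c d) - convolution r (basis_elt c) d"
    have "convolution (basis_elt b) ?r = basis_elt b" if "b \<in> insert c A" for b
      using that r
      by (auto simp: convolution_diff_right convolution_add_right convolution_basis_elt
          basis_elt_sandwich[folded convolution_assoc] band_idem simp flip: convolution_assoc)
    then show ?case by blast
  qed auto
  then obtain r :: "'b \<Rightarrow> 'k" where "\<And>b. convolution (basis_elt b) r = basis_elt b"
    using finite[of UNIV] by blast
  then have "convolution f r = f" for f
    by (simp add: fun_eq_iff convolution_expand_left[of f])
  then show ?thesis by blast
qed

text \<open>With a right identity \<open>r\<close>, the elements \<open>r b - b\<close> are annihilated from the left.  Their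
  coefficient at \<open>x\<close> does not depend on \<open>b\<close> above \<open>supp x\<close>, by connectedness.\<close>

lemma annihilated_eq_0:
  fixes u :: "'b::left_regular_band \<Rightarrow> 'k::field"
  assumes conn: "connected_lrb TYPE('b)"
    and u: "\<And>a. convolution (basis_elt a) u = (\<lambda>_. 0)"
  shows "u x = 0"
  using u
\<comment> \<open>Induction from large supports to small ones. The element \<open>u\<close> stays
  arbitrary because the hypothesis is also needed for the elements \<open>v b\<close> below.\<close>
proof (induction x arbitrary: u rule: measure_induct_rule[where f = "\<lambda>x. card (- supp x)"])
  case (less x)
  obtain r :: "'b \<Rightarrow> 'k" where r: "\<And>f. convolution f r = f"
    using right_identity_exists by blast
  have above: "w d = 0"
    if "\<And>a. convolution (basis_elt a) w = (\<lambda>_. 0)" "x * d = x" "supp d \<noteq> supp x"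
    for w :: "'b \<Rightarrow> 'k" and d
  proof (rule less.IH[OF _ that(1)])
    have "supp x \<subset> supp d" using that(2,3) supp_subset_iff by blast
    then show "card (- supp d) < card (- supp x)" by (intro psubset_card_mono) auto
  qed
  define v where "v b = (\<lambda>d. convolution r (basis_elt b) d - basis_elt b d)" for b
  have v: "convolution (basis_elt a) (v b) = (\<lambda>_. 0)" for a b
    by (simp add: v_def convolution_diff_right r flip: convolution_assoc)
  \<comment> \<open>Since \<open>q c = c\<close>, the element \<open>v c = r c - c\<close> equals
    \<open>(r q - q) c\<close>, that is, \<open>v q\<close> times \<open>c\<close>.\<close>
  have v_below: "v c x = v q x" if c: "supp c = supp x" "q * c = c" for c q
  proof -
    have "v c = convolution (v q) (basis_elt c)"
      by (simp add: v_def convolution_diff_left convolution_assoc convolution_basis_elt c)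
    then have "v c x = (\<Sum>a\<in>UNIV. if a * c = x then v q a else 0)"
      by (simp add: convolution_basis_elt_right)
    also have "\<dots> = (\<Sum>a\<in>UNIV. if a = x then v q a else 0)"
    proof (rule sum.cong)
      fix a
      have xc: "x * c = x" using c(1) supp_subset_iff by blast
      show "(if a * c = x then v q a else 0) = (if a = x then v q a else 0)"
      proof (cases "a * c = x \<and> a \<noteq> x")
        \<comment> \<open>Such an \<open>a\<close> has support strictly above \<open>supp x\<close>,
          where \<open>v q\<close> vanishes by the induction hypothesis.\<close>
        case True
        then have "x * a = x" by (metis left_regular)
        moreover have "supp a \<noteq> supp x"
          using True c(1) by (metis order_refl supp_subset_iff)
        ultimately have "v q a = 0" by (rule above[OF v])
        then show ?thesis using True by simp
      qed (use xc in auto)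
    qed simp
    finally show ?thesis by simp
  qed
  \<comment> \<open>The element \<open>p * x\<close> has the support of \<open>x\<close> and lies
    below both ends of the edge, so both values agree with that of \<open>v (p * x)\<close> at
    \<open>x\<close>.\<close>
  have v_edge: "v p x = v q x" if "(p, q) \<in> hasse_edges (elts_above (supp x))" for p q
  proof -
    have *: "x * p = x" "q * p = p"
      using that by (auto simp: hasse_edges_def elts_above_def lrb_less_def lrb_le_def
          supp_subset_iff)
    have "supp (p * x) = supp x"
      using *(1) by (simp add: set_eq_subset supp_subset_iff) (metis band_idem mult.assoc)
    moreover have "q * (p * x) = p * x" "p * (p * x) = p * x"
      using *(2) by (metis mult.assoc, metis band_idem mult.assoc)
    ultimately show ?thesis using v_below by metis
  qed
  \<comment> \<open>Walk from \<open>x\<close> to \<open>b\<close> along the Hasse diagram of the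
    elements above \<open>supp x\<close>.\<close>
  have "x * b = x \<Longrightarrow> v x x = v b x" for b
  proof -
    assume "x * b = x"
    then have "b \<in> elts_above (supp x)" "x \<in> elts_above (supp x)"
      by (simp_all add: elts_above_def supp_subset_iff band_idem)
    moreover have "hasse_connected (elts_above (supp x))"
      using conn by (auto simp: connected_lrb_def supports_def)
    ultimately have "(x, b)
        \<in> (hasse_edges (elts_above (supp x)) \<union> (hasse_edges (elts_above (supp x)))\<inverse>)\<^sup>*"
      by (simp add: hasse_connected_def)
    then show "v x x = v b x"
      by induction (use v_edge in auto)
  qed
  note v_const = this
  \<comment> \<open>The right identity is a combination of basis elements, each of which annihilates
    \<open>u\<close>.\<close>
  have "0 = convolution r u x"
    by (simp add: convolution_expand_left[of r] less.prems)
  also have "\<dots> = (\<Sum>b\<in>UNIV. u b * convolution r (basis_elt b) x)"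
    by (rule convolution_expand_right)
  also have "\<dots> = (\<Sum>b\<in>UNIV. u b * basis_elt b x + v x x * (if x * b = x then u b else 0))"
  proof (rule sum.cong)
    fix b
    show "u b * convolution r (basis_elt b) x
        = u b * basis_elt b x + v x x * (if x * b = x then u b else 0)"
    proof (cases "x * b = x")
      case True
      then have "convolution r (basis_elt b) x = basis_elt b x + v x x"
        using v_const[of b] by (simp add: v_def[of b])
      then show ?thesis using True by (simp add: distrib_left mult.commute)
    next
      case False
      \<comment> \<open>Here \<open>x\<close> is not in the left ideal of \<open>b\<close>, so both
        coefficients at \<open>x\<close> vanish.\<close>
      then have "a * b \<noteq> x" for a
        by (metis band_idem mult.assoc)
      moreover from this[of b] have "x \<noteq> b"
        by (auto simp: band_idem)
      ultimately show ?thesis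
        using False by (simp add: convolution_basis_elt_right) (simp add: basis_elt_def)
    qed
  qed simp
  also have "\<dots> = u x + v x x * (\<Sum>b\<in>UNIV. if x * b = x then u b else 0)"
    by (simp add: sum.distrib sum_distrib_left)
  \<comment> \<open>This sum is the coefficient at \<open>x\<close> of the product of
    \<open>x\<close> and \<open>u\<close>, which is zero.\<close>
  also have "(\<Sum>b\<in>UNIV. if x * b = x then u b else 0) = 0"
    using less.prems[of x] by (simp add: fun_eq_iff flip: convolution_basis_elt_left)
  finally show ?case by simp
qed

text \<open>For a right identity \<open>r\<close>, every \<open>r f - f\<close> is annihilated from
  the left, hence zero; so \<open>r\<close> is two-sided.\<close>

theorem connected_lrb_identity:
  assumes "connected_lrb TYPE('b::left_regular_band)"
  shows "\<exists>!e :: 'b \<Rightarrow> 'k::field. \<forall>f. convolution e f = f \<and> convolution f e = f"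
proof -
  obtain r :: "'b \<Rightarrow> 'k" where r: "\<And>f. convolution f r = f"
    using right_identity_exists by blast
  have "convolution r f d - f d = 0" for f d
    using annihilated_eq_0[OF assms, of "\<lambda>d. convolution r f d - f d"]
    by (simp add: convolution_diff_right r flip: convolution_assoc)
  with r show ?thesis
    by (intro ex1I[of _ r]) (auto simp: fun_eq_iff, metis)
qed

section \<open>The characters of the semigroup algebra\<close>

definition support_char :: "'b::left_regular_band \<Rightarrow> ('b \<Rightarrow> 'k::field) \<Rightarrow> 'k"
  where "support_char c f = (\<Sum>a | c * a = c. f a)"

lemma support_char_alt: "support_char c f = (\<Sum>a\<in>UNIV. f a * (if c * a = c then 1 else 0))"
  by (simp add: support_char_def mult_delta_right sum.If_cases)

lemma support_char_0 [simp]: "support_char c (\<lambda>_. 0) = 0"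
  by (simp add: support_char_def)

lemma support_char_add: "support_char c (\<lambda>b. f b + h b) = support_char c f + support_char c h"
  by (simp add: support_char_def sum.distrib)

lemma support_char_diff: "support_char c (\<lambda>b. f b - h b) = support_char c f - support_char c h"
  by (simp add: support_char_def sum_subtractf)

lemma support_char_smult: "support_char c (\<lambda>b. t * f b) = t * support_char c f"
  by (simp add: support_char_def sum_distrib_left)

lemma support_char_convolution:
  "support_char c (convolution f h) = support_char c f * support_char c h"
proof -
  let ?F = "\<lambda>a. if c * a = c then 1 else 0"
  have "support_char c (convolution f h) = (\<Sum>a\<in>UNIV. \<Sum>b\<in>UNIV. (f a * ?F a) * (h b * ?F b))"
    unfolding support_char_alt sum_convolution
    by (intro sum.cong) (auto simp: supp_subset_mult_iff)
  then show ?thesis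
    unfolding support_char_alt sum_product .
qed

lemma support_char_cong:
  assumes "supp c = supp d" shows "support_char c f = support_char d f"
proof -
  have "{a. c * a = c} = {a. d * a = d}"
    using assms by (simp flip: supp_subset_iff)
  then show ?thesis by (simp add: support_char_def)
qed

section \<open>Coefficients at elements of maximal support\<close>

lemma maximal_support:
  fixes f :: "'b::left_regular_band \<Rightarrow> 'k::field"
  assumes "f b \<noteq> 0"
  shows "\<exists>x. f x \<noteq> 0 \<and> (\<forall>a. x * a = x \<longrightarrow> supp a \<noteq> supp x \<longrightarrow> f a = 0)"
proof -
  have bound: "\<forall>y. f y \<noteq> 0 \<longrightarrow> card (supp y) < Suc (card (UNIV :: 'b set))"
    by (simp add: card_mono le_imp_less_Suc)
  obtain x where x: "f x \<noteq> 0" "\<forall>y. f y \<noteq> 0 \<longrightarrow> card (supp y) \<le> card (supp x)"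
    using ex_has_greatest_nat[where P = "\<lambda>y. f y \<noteq> 0", OF assms bound] by blast
  have "f a = 0" if "x * a = x" "supp a \<noteq> supp x" for a
  proof -
    have "supp x \<subset> supp a" using that supp_subset_iff by blast
    then have "card (supp x) < card (supp a)" by (intro psubset_card_mono) auto
    then show ?thesis using x(2) by (meson not_le)
  qed
  with x(1) show ?thesis by blast
qed

text \<open>If \<open>a * b = x\<close>, then \<open>supp a\<close> contains \<open>supp x\<close>.
  Strictly larger supports contribute nothing, and equal supports force
  \<open>a = a * x = a * a * b = x\<close>. What remains is the sum over the \<open>b\<close> with
  \<open>x * b = x\<close>.\<close>

lemma convolution_at_maximal:
  fixes f h :: "'b::left_regular_band \<Rightarrow> 'k::field"
  assumes "\<And>a. x * a = x \<Longrightarrow> supp a \<noteq> supp x \<Longrightarrow> f a = 0"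
  shows "convolution f h x = f x * support_char x h"
proof -
  have "f a * h b * basis_elt x (a * b)
      = (if a = x then f x * (h b * (if x * b = x then 1 else 0)) else 0)" for a b
  proof (cases "a * b = x \<and> a \<noteq> x")
    case True
    then have "x * a = x" by (metis left_regular)
    moreover have "supp a \<noteq> supp x"
    proof
      assume "supp a = supp x"
      then have "a * x = a" by (simp add: supp_eq_iff)
      then show False using True by (metis band_idem mult.assoc)
    qed
    ultimately have "f a = 0" by (rule assms)
    then show ?thesis using True by simp
  qed (auto simp: basis_elt_def)
  then show ?thesis
    by (simp add: convolution_apply support_char_alt sum_distrib_left)
      (subst sum.swap, simp)
qed

section \<open>Coordinates in the semigroup algebra\<close>

lemma semigroup_algebra_simps [simp]:
  fixes f h :: "'b::left_regular_band \<Rightarrow> 'k::field"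
  shows "carrier (semigroup_algebra :: ('k, 'b \<Rightarrow> 'k) module) = UNIV"
    and "f \<otimes>\<^bsub>semigroup_algebra\<^esub> h = convolution f h"
    and "\<zero>\<^bsub>semigroup_algebra\<^esub> = (\<lambda>_ :: 'b. 0 :: 'k)"
    and "f \<oplus>\<^bsub>semigroup_algebra\<^esub> h = (\<lambda>b. f b + h b)"
    and "c \<odot>\<^bsub>semigroup_algebra\<^esub> f = (\<lambda>b. c * f b)"
  by (simp_all add: semigroup_algebra_def)

lemma abelian_monoid_semigroup_algebra:
  "abelian_monoid (semigroup_algebra :: ('k::field, 'b::left_regular_band \<Rightarrow> 'k) module)"
  by (rule abelian_monoidI) (auto simp: add_ac)

lemma finsum_semigroup_algebra:
  fixes F :: "'i \<Rightarrow> 'b::left_regular_band \<Rightarrow> 'k::field"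
  assumes "finite I"
  shows "(\<Oplus>\<^bsub>semigroup_algebra\<^esub>i\<in>I. F i) = (\<lambda>b. \<Sum>i\<in>I. F i b)"
proof -
  interpret abelian_monoid "semigroup_algebra :: ('k, 'b \<Rightarrow> 'k) module"
    by (rule abelian_monoid_semigroup_algebra)
  show ?thesis
    using assms
    by (induction I) (simp_all add: finsum_insert)
qed

lemma sum_elt_apply: "sum_elt S a = (if a \<in> S then 1 else 0)"
  by (simp add: sum_elt_def finsum_semigroup_algebra basis_elt_def)

lemma support_char_sum_elt:
  "support_char c (sum_elt S :: 'b::left_regular_band \<Rightarrow> 'k::field)
    = of_nat (count_above S (supp c))"
  by (simp add: support_char_def sum_elt_apply count_above_def supp_subset_iff sum.If_cases
    Int_def conj_commute)

lemma linear_extension_eq_iff: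
  fixes f :: "'b::left_regular_band \<Rightarrow> 'k::field"
  assumes "bij s"
  shows "linear_extension s f = f \<longleftrightarrow> (\<forall>c. f (s c) = f c)"
proof -
  have *: "linear_extension s f (s c) = f c" for c
  proof -
    have "basis_elt (s b) (s c) = (basis_elt b c :: 'k)" for b
      using bij_is_inj[OF assms] by (auto simp: basis_elt_def inj_eq)
    then show ?thesis
      by (simp add: linear_extension_def finsum_semigroup_algebra)
  qed
  then show ?thesis
    by (metis assms bij_pointE ext)
qed

lemma convolution_automorphism:
  fixes f h :: "'b::left_regular_band \<Rightarrow> 'k::field"
  assumes "bij s" "\<And>a b. s (a * b) = s a * s b"
  shows "convolution f h (s c) = convolution (\<lambda>a. f (s a)) (\<lambda>a. h (s a)) c"
proof -
  have "basis_elt (s c) (s a * s b) = (basis_elt c (a * b) :: 'k)" for a b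
    using bij_is_inj[OF assms(1)] by (auto simp: basis_elt_def inj_eq simp flip: assms(2))
  moreover have "convolution f h (s c)
    = (\<Sum>a\<in>UNIV. \<Sum>b\<in>UNIV. f (s a) * h (s b) * basis_elt (s c) (s a * s b))"
  proof -
    have reindex: "(\<Sum>b\<in>UNIV. F (s b)) = sum F UNIV" for F :: "'b \<Rightarrow> 'k"
      by (rule sum.reindex_bij_betw[OF assms(1)])
    have "(\<Sum>b\<in>UNIV. f (s a) * h (s b) * basis_elt (s c) (s a * s b))
        = (\<Sum>b\<in>UNIV. f (s a) * h b * basis_elt (s c) (s a * b))" for a
      by (rule reindex[of "\<lambda>b. f (s a) * h b * basis_elt (s c) (s a * b)"])
    then show ?thesis
      using reindex[of "\<lambda>a. \<Sum>b\<in>UNIV. f a * h b * basis_elt (s c) (a * b)"]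
      by (simp add: convolution_apply)
  qed
  ultimately show ?thesis by (simp add: convolution_apply)
qed

section \<open>Invariants\<close>

locale lrb_action = group_action G UNIV \<phi>
  for G :: "('g, 'm) monoid_scheme" (structure)
    and \<phi> :: "'g \<Rightarrow> 'b::left_regular_band \<Rightarrow> 'b" +
  assumes finite_group: "finite (carrier G)"
    and action_mult: "g \<in> carrier G \<Longrightarrow> \<phi> g (a * b) = \<phi> g a * \<phi> g b"
begin

sublocale group G
  using group_hom by (rule group_hom.axioms(1))

lemma bij_action: "g \<in> carrier G \<Longrightarrow> bij (\<phi> g)"
  using bij_prop0 by (auto simp: Bij_def)

lemma action_eq_iff [simp]: "g \<in> carrier G \<Longrightarrow> \<phi> g a = \<phi> g b \<longleftrightarrow> a = b"
  using bij_action bij_is_inj inj_eq by metis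

lemma action_one [simp]: "\<phi> \<one> b = b"
  using id_eq_one by (metis UNIV_I restrict_apply')

lemma action_comp: "g \<in> carrier G \<Longrightarrow> h \<in> carrier G \<Longrightarrow> \<phi> (g \<otimes> h) b = \<phi> g (\<phi> h b)"
  by (rule composition_rule) auto

lemma action_inv [simp]:
  "g \<in> carrier G \<Longrightarrow> \<phi> (inv g) (\<phi> g b) = b" "g \<in> carrier G \<Longrightarrow> \<phi> g (\<phi> (inv g) b) = b"
  by (simp_all flip: action_comp)

lemma supp_action: "g \<in> carrier G \<Longrightarrow> supp (\<phi> g b) = \<phi> g ` supp b"
  using image_supp[OF bij_action action_mult] by auto

lemma card_supp_action: "g \<in> carrier G \<Longrightarrow> card (supp (\<phi> g b)) = card (supp b)"
  by (simp add: supp_action card_image inj_on_def)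

section \<open>Orbits of elements and orbits of supports\<close>

lemma orbit_eq_iff: "orbit G \<phi> a = orbit G \<phi> b \<longleftrightarrow> (\<exists>g\<in>carrier G. a = \<phi> g b)"
proof
  assume "orbit G \<phi> a = orbit G \<phi> b"
  then have "a \<in> orbit G \<phi> b" using orbit_refl by auto
  then show "\<exists>g\<in>carrier G. a = \<phi> g b" by (auto simp: orbit_def)
next
  assume "\<exists>g\<in>carrier G. a = \<phi> g b"
  then have "a \<in> orbit G \<phi> b" by (auto simp: orbit_def)
  then show "orbit G \<phi> a = orbit G \<phi> b"
    using orbit_trans orbit_sym by blast
qed

lemma orbit_support: "orbit G (support_action \<phi>) (supp b) = supp ` orbit G \<phi> b"
  by (simp add: orbit_def support_action_def setcompr_eq_image image_image supp_action
      cong: image_cong)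

lemma orbit_support_eq_iff:
  "orbit G (support_action \<phi>) (supp a) = orbit G (support_action \<phi>) (supp b)
    \<longleftrightarrow> (\<exists>g\<in>carrier G. supp a = supp (\<phi> g b))"
proof
  assume "orbit G (support_action \<phi>) (supp a) = orbit G (support_action \<phi>) (supp b)"
  moreover have "supp a \<in> supp ` orbit G \<phi> a" using orbit_refl by blast
  ultimately have "supp a \<in> supp ` orbit G \<phi> b" by (simp add: orbit_support)
  then show "\<exists>g\<in>carrier G. supp a = supp (\<phi> g b)" by (auto simp: orbit_def)
next
  assume "\<exists>g\<in>carrier G. supp a = supp (\<phi> g b)"
  then obtain g where g: "g \<in> carrier G" "supp a = supp (\<phi> g b)" by blast
  have "orbit G \<phi> (\<phi> g b) = orbit G \<phi> b" using g(1) orbit_eq_iff by blast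
  then show "orbit G (support_action \<phi>) (supp a) = orbit G (support_action \<phi>) (supp b)"
    by (simp add: g(2) orbit_support)
qed

lemma orbits_supports: "orbits G supports (support_action \<phi>) = (`) supp ` orbits G UNIV \<phi>"
proof -
  have "orbits G supports (support_action \<phi>) = range (\<lambda>b. orbit G (support_action \<phi>) (supp b))"
    "orbits G UNIV \<phi> = range (orbit G \<phi>)"
    by (auto simp: orbits_def supports_def)
  then show ?thesis by (simp add: orbit_support image_image)
qed

text \<open>Taking supports maps the orbits of elements onto the orbits of supports. By finiteness,
  the numbers agree exactly if this map is injective.\<close>

lemma card_orbits_eq_iff:
  "card (orbits G UNIV \<phi>) = card (orbits G supports (support_action \<phi>))
    \<longleftrightarrow> (\<forall>a b. supp a = supp b \<longrightarrow> orbit G \<phi> a = orbit G \<phi> b)"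
proof -
  have "card (orbits G UNIV \<phi>) = card (orbits G supports (support_action \<phi>))
      \<longleftrightarrow> inj_on ((`) supp) (orbits G UNIV \<phi>)"
    unfolding orbits_supports by (metis card_image eq_card_imp_inj_on finite)
  also have "\<dots> \<longleftrightarrow> (\<forall>a b. supp a = supp b \<longrightarrow> orbit G \<phi> a = orbit G \<phi> b)"
  proof
    assume inj: "inj_on ((`) supp) (orbits G UNIV \<phi>)"
    show "\<forall>a b. supp a = supp b \<longrightarrow> orbit G \<phi> a = orbit G \<phi> b"
    proof (intro allI impI)
      fix a b :: 'b assume "supp a = supp b"
      then have "supp ` orbit G \<phi> a = supp ` orbit G \<phi> b" by (simp flip: orbit_support)
      then show "orbit G \<phi> a = orbit G \<phi> b"
        by (rule inj_onD[OF inj]) (auto simp: orbits_def)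
    qed
  next
    assume *: "\<forall>a b. supp a = supp b \<longrightarrow> orbit G \<phi> a = orbit G \<phi> b"
    \<comment> \<open>Equal image orbits give equal supports only after translating
      \<open>b\<close>, which does not change its orbit.\<close>
    have "orbit G \<phi> a = orbit G \<phi> b" if "supp ` orbit G \<phi> a = supp ` orbit G \<phi> b" for a b
    proof -
      obtain g where "g \<in> carrier G" "supp a = supp (\<phi> g b)"
        using \<open>supp ` orbit G \<phi> a = _\<close> orbit_support_eq_iff by (metis orbit_support)
      then show ?thesis using * orbit_eq_iff by metis
    qed
    then show "inj_on ((`) supp) (orbits G UNIV \<phi>)"
      by (auto simp: inj_on_def orbits_def)
  qed
  finally show ?thesis .
qed

text \<open>By Lagrange, \<open>card H\<close> divides the order of \<open>G\<close>. The hypothesis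
  on the characteristic enters through this lemma.\<close>

lemma of_nat_card_subgroup:
  assumes "\<not> CHAR('k::field) dvd Coset.order G" "subgroup H G"
  shows "(of_nat (card H) :: 'k) \<noteq> 0"
  using lagrange[OF assms(2)] assms(1) by (metis dvd_mult of_nat_eq_0_iff_char_dvd)

text \<open>The condition only asks for an inclusion of supports, but translates have supports of
  equal size, so this is the stabilizer of \<open>supp c\<close>.\<close>

lemma subgroup_support_stabilizer: "subgroup {g\<in>carrier G. c * \<phi> g c = c} G"
proof (rule subgroupI)
  fix g assume g: "g \<in> {g\<in>carrier G. c * \<phi> g c = c}"
  then have "supp (\<phi> g c) = supp c"
    by (intro supp_eq_if_card) (auto simp: card_supp_action)
  then have "\<phi> g c * c = \<phi> g c"
    by (simp add: supp_eq_iff)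
  then have "\<phi> (inv g) (\<phi> g c * c) = \<phi> (inv g) (\<phi> g c)"
    by simp
  then show "inv g \<in> {g\<in>carrier G. c * \<phi> g c = c}"
    using g by (simp add: action_mult flip: action_comp)
next
  fix g h assume gh: "g \<in> {g\<in>carrier G. c * \<phi> g c = c}" "h \<in> {g\<in>carrier G. c * \<phi> g c = c}"
  then have "\<phi> g (c * \<phi> h c) = \<phi> g c" "c * \<phi> g c = c" by auto
  then have "c * \<phi> g (\<phi> h c) = c"
    using gh by (metis (no_types, lifting) action_mult mem_Collect_eq mult.assoc)
  then show "g \<otimes> h \<in> {g\<in>carrier G. c * \<phi> g c = c}"
    using gh by (simp add: action_comp)
qed (auto simp: band_idem intro: exI[of _ \<one>])

section \<open>The algebra of invariants\<close>

definition invariant :: "('b \<Rightarrow> 'k::field) \<Rightarrow> bool" where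
  "invariant f \<longleftrightarrow> (\<forall>g\<in>carrier G. \<forall>b. f (\<phi> g b) = f b)"

lemma carrier_invariant_algebra: "carrier (invariant_algebra G \<phi>) = Collect invariant"
  by (auto simp: invariant_algebra_def invariant_def linear_extension_eq_iff bij_action)

lemma invariant_algebra_simps [simp]:
  fixes f h :: "'b::left_regular_band \<Rightarrow> 'k::field"
  shows "f \<otimes>\<^bsub>invariant_algebra G \<phi>\<^esub> h = convolution f h"
    and "\<zero>\<^bsub>invariant_algebra G \<phi>\<^esub> = (\<lambda>_ :: 'b. 0 :: 'k)"
    and "f \<oplus>\<^bsub>invariant_algebra G \<phi>\<^esub> h = (\<lambda>b. f b + h b)"
    and "c \<odot>\<^bsub>invariant_algebra G \<phi>\<^esub> f = (\<lambda>b. c * f b)"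
  by (simp_all add: invariant_algebra_def)

lemma invariant_convolution: "invariant f \<Longrightarrow> invariant h \<Longrightarrow> invariant (convolution f h)"
  by (simp add: invariant_def convolution_automorphism bij_action action_mult)

lemma invariant_one:
  assumes "connected_lrb TYPE('b)"
  defines "e \<equiv> \<one>\<^bsub>invariant_algebra G \<phi>\<^esub> :: 'b \<Rightarrow> 'k::field"
  shows "invariant e" "convolution e f = f" "convolution f e = f"
proof -
  have e: "convolution e f = f \<and> convolution f e = f" for f
    using theI'[OF connected_lrb_identity[OF assms(1), where 'k = 'k]]
    by (simp add: e_def invariant_algebra_def semigroup_algebra_def)
  then show "convolution e f = f" "convolution f e = f" by auto
  show "invariant e"
    unfolding invariant_def
  proof (intro ballI allI)
    fix g b assume g: "g \<in> carrier G"
    \<comment> \<open>The translate of \<open>e\<close> is again a left identity, and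
      \<open>e\<close> is a right identity, so the two coincide.\<close>
    have "convolution (\<lambda>a. e (\<phi> g a)) f = f" for f
    proof
      fix c
      have *: "\<phi> g (\<phi> (inv g) a) = a" "\<phi> (inv g) (\<phi> g a) = a" for a
        using g by (simp_all flip: action_comp)
      have "convolution (\<lambda>a. e (\<phi> g a)) f c
          = convolution (\<lambda>a. e (\<phi> g a)) (\<lambda>a. (\<lambda>b. f (\<phi> (inv g) b)) (\<phi> g a)) c"
        by (simp add: *)
      \<comment> \<open>With both factors composed with \<open>\<phi> g\<close>, the automorphism
        can be moved out of the convolution.\<close>
      also have "\<dots> = convolution e (\<lambda>b. f (\<phi> (inv g) b)) (\<phi> g c)"
        by (rule convolution_automorphism[symmetric]) (use g in \<open>auto simp: bij_action action_mult\<close>)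
      finally show "convolution (\<lambda>a. e (\<phi> g a)) f c = f c"
        by (simp add: e *)
    qed
    then show "e (\<phi> g b) = e b" using e by metis
  qed
qed

lemma unital_algebra_invariant:
  assumes "connected_lrb TYPE('b)"
  shows "unital_algebra (invariant_algebra G \<phi> :: ('k::field, 'b \<Rightarrow> 'k) module)"
proof -
  note one = invariant_one[OF assms, where 'k = 'k]
  have "ring (invariant_algebra G \<phi> :: ('k, 'b \<Rightarrow> 'k) module)"
  proof (rule ringI)
    show "abelian_group (invariant_algebra G \<phi> :: ('k, 'b \<Rightarrow> 'k) module)"
    proof (rule abelian_groupI)
      fix f :: "'b \<Rightarrow> 'k" assume "f \<in> carrier (invariant_algebra G \<phi>)"
      then show "\<exists>h\<in>carrier (invariant_algebra G \<phi>).
          h \<oplus>\<^bsub>invariant_algebra G \<phi>\<^esub> f = \<zero>\<^bsub>invariant_algebra G \<phi>\<^esub>"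
        by (intro bexI[of _ "\<lambda>b. - f b"]) (auto simp: carrier_invariant_algebra invariant_def)
    qed (auto simp: carrier_invariant_algebra invariant_def add_ac)
    show "Group.monoid (invariant_algebra G \<phi> :: ('k, 'b \<Rightarrow> 'k) module)"
      by (rule monoidI)
        (simp_all add: carrier_invariant_algebra invariant_convolution one convolution_assoc)
  qed (simp_all add: convolution_add_left convolution_add_right)
  then show ?thesis
    by (intro unital_algebra.intro unital_algebra_axioms.intro)
      (auto simp: carrier_invariant_algebra invariant_def algebra_simps
        convolution_smult_left convolution_smult_right)
qed

section \<open>Orbit sums and the values of characters on them\<close>

definition orbit_sum :: "'b \<Rightarrow> 'b \<Rightarrow> 'k::field" where
  "orbit_sum b a = (\<Sum>g\<in>carrier G. basis_elt (\<phi> g b) a)"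

text \<open>Summing over the group rather than the orbit counts elements with multiplicity. Thus
  coefficients and character values are sizes of subsets of \<open>G\<close>, and subgroups arise at
  the element itself.\<close>

lemma orbit_sum_eq: "orbit_sum b a = of_nat (card {g\<in>carrier G. \<phi> g b = a})"
  by (simp add: orbit_sum_def basis_elt_def finite_group eq_commute flip: sum.inter_filter)

lemma invariant_orbit_sum: "invariant (orbit_sum b :: 'b \<Rightarrow> 'k::field)"
  unfolding invariant_def
proof (intro ballI allI)
  fix h a assume h: "h \<in> carrier G"
  have "orbit_sum b (\<phi> h a) = ((\<Sum>g\<in>carrier G. basis_elt (\<phi> (h \<otimes> g) b) (\<phi> h a)) :: 'k)"
    unfolding orbit_sum_def
    by (rule sum.reindex_bij_witness[of _ "\<lambda>g. h \<otimes> g" "\<lambda>g. inv h \<otimes> g"])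
      (use h in \<open>auto simp flip: m_assoc\<close>)
  also have "\<dots> = orbit_sum b a"
    unfolding orbit_sum_def
    by (rule sum.cong) (use h in \<open>auto simp: action_comp basis_elt_def\<close>)
  finally show "orbit_sum b (\<phi> h a) = (orbit_sum b a :: 'k)" .
qed

lemma support_char_orbit_sum:
  "support_char c (orbit_sum b) = of_nat (card {g\<in>carrier G. c * \<phi> g b = c})"
proof -
  have "support_char c (orbit_sum b)
      = (\<Sum>g\<in>carrier G. \<Sum>a\<in>UNIV. (if c * a = c then 1 else 0) * basis_elt (\<phi> g b) a)"
    unfolding support_char_alt orbit_sum_def sum_distrib_right
    by (subst sum.swap) (simp only: mult_ac)
  also have "\<dots> = of_nat (card {g\<in>carrier G. c * \<phi> g b = c})"
    by (simp only: sum_basis_elt) (simp add: finite_group flip: sum.inter_filter)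
  finally show ?thesis .
qed

text \<open>Translates of \<open>c\<close> have supports of the same size, so none lies strictly
  above \<open>supp c\<close>. Hence \<open>c\<close> is maximal for its own orbit sum.\<close>

lemma orbit_sum_above:
  assumes "c * a = c" "supp a \<noteq> supp c" shows "orbit_sum c a = 0"
proof -
  have "\<phi> g c \<noteq> a" if "g \<in> carrier G" for g
    using supp_eq_if_card[OF assms(1)] card_supp_action[OF that, of c] assms(2) by auto
  then have "{g\<in>carrier G. \<phi> g c = a} = {}" by blast
  then show ?thesis by (simp only: orbit_sum_eq card.empty of_nat_0)
qed

lemma support_char_invariant:
  assumes "invariant f" "g \<in> carrier G"
  shows "support_char (\<phi> g c) f = support_char c f"
proof -
  have "c * \<phi> (inv g) a = c" if "\<phi> g c * a = \<phi> g c" for a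
    using assms(2) action_mult[of "inv g" "\<phi> g c" a] that by simp
  then show ?thesis
    unfolding support_char_def
    by (intro sum.reindex_bij_witness[of _ "\<phi> g" "\<phi> (inv g)"])
      (use assms in \<open>auto simp: invariant_def simp flip: action_mult\<close>)
qed

lemma orbit_sum_self_nonzero:
  assumes "\<not> CHAR('k::field) dvd Coset.order G"
  shows "(orbit_sum b b :: 'k) \<noteq> 0"
  using of_nat_card_subgroup[OF assms stabilizer_subgroup[of b]]
  by (simp add: orbit_sum_eq stabilizer_def)

lemma support_char_orbit_sum_self_nonzero:
  assumes "\<not> CHAR('k::field) dvd Coset.order G"
  shows "support_char c (orbit_sum c :: 'b \<Rightarrow> 'k) \<noteq> 0"
  using of_nat_card_subgroup[OF assms subgroup_support_stabilizer]
  by (simp add: support_char_orbit_sum)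

section \<open>Separation of invariants and of orbits by characters\<close>

lemma support_chars_injective_if_commutative:
  fixes f :: "'b \<Rightarrow> 'k::field"
  assumes char: "\<not> CHAR('k) dvd Coset.order G"
    and comm: "\<And>h :: 'b \<Rightarrow> 'k. invariant h \<Longrightarrow> convolution f h = convolution h f"
    and zero: "\<And>c. support_char c f = 0"
  shows "f = (\<lambda>_. 0)"
proof (rule ccontr)
  assume "f \<noteq> (\<lambda>_. 0)"
  then obtain b where "f b \<noteq> 0" by auto
  then obtain c where c: "f c \<noteq> 0" "\<And>a. c * a = c \<Longrightarrow> supp a \<noteq> supp c \<Longrightarrow> f a = 0"
    using maximal_support by blast
  \<comment> \<open>One coefficient is computed in both orders, as \<open>c\<close> is maximal both
    for \<open>f\<close> and for its orbit sum.\<close>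
  have "f c * support_char c (orbit_sum c) = convolution f (orbit_sum c) c"
    by (rule convolution_at_maximal[symmetric]) (rule c(2))
  also have "\<dots> = convolution (orbit_sum c) f c"
    by (simp add: comm invariant_orbit_sum)
  also have "\<dots> = orbit_sum c c * support_char c f"
    by (rule convolution_at_maximal) (rule orbit_sum_above)
  finally show False
    using c(1) zero support_char_orbit_sum_self_nonzero[OF char, of c] by simp
qed

text \<open>Elements strictly above \<open>supp c\<close> contribute nothing; those with the same
  support lie in one orbit, on which \<open>f\<close> is constant.\<close>

lemma support_char_at_maximal:
  fixes f :: "'b \<Rightarrow> 'k::field"
  assumes f: "invariant f" "\<And>a. c * a = c \<Longrightarrow> supp a \<noteq> supp c \<Longrightarrow> f a = 0"
    and orb: "\<And>a. supp a = supp c \<Longrightarrow> orbit G \<phi> a = orbit G \<phi> c"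
  shows "support_char c f = of_nat (card {a. supp a = supp c}) * f c"
proof -
  have "support_char c f = (\<Sum>a | supp a = supp c. f a)"
    unfolding support_char_def
    by (rule sum.mono_neutral_right) (use f(2) in \<open>auto simp: supp_eq_iff\<close>)
  also have "\<dots> = (\<Sum>a | supp a = supp c. f c)"
  proof (rule sum.cong)
    fix a assume "a \<in> {a. supp a = supp c}"
    then obtain g where "g \<in> carrier G" "a = \<phi> g c"
      using orb orbit_eq_iff by blast
    then show "f a = f c" using f(1) by (simp add: invariant_def)
  qed simp
  finally show ?thesis by simp
qed

text \<open>At a maximal \<open>c\<close> the character is a multiple of \<open>f c\<close>, but the
  factor, a number of elements, might vanish in the field. The same formula for the orbit sum of
  \<open>c\<close>, whose character is nonzero, excludes this.\<close>

lemma support_chars_injective_if_orbits: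
  fixes f :: "'b \<Rightarrow> 'k::field"
  assumes char: "\<not> CHAR('k) dvd Coset.order G"
    and orb: "\<And>a b. supp a = supp b \<Longrightarrow> orbit G \<phi> a = orbit G \<phi> b"
    and f: "invariant f" "\<And>c. support_char c f = 0"
  shows "f = (\<lambda>_. 0)"
proof (rule ccontr)
  assume "f \<noteq> (\<lambda>_. 0)"
  then obtain b where "f b \<noteq> 0" by auto
  then obtain c where c: "f c \<noteq> 0" "\<And>a. c * a = c \<Longrightarrow> supp a \<noteq> supp c \<Longrightarrow> f a = 0"
    using maximal_support by blast
  have "support_char c f = of_nat (card {a. supp a = supp c}) * f c"
    using f(1) c(2) orb by (rule support_char_at_maximal)
  then have "of_nat (card {a. supp a = supp c}) = (0 :: 'k)"
    using f(2) c(1) by simp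
  moreover have "support_char c (orbit_sum c)
      = of_nat (card {a. supp a = supp c}) * (orbit_sum c c :: 'k)"
    using invariant_orbit_sum orbit_sum_above orb by (rule support_char_at_maximal)
  ultimately show False
    using support_char_orbit_sum_self_nonzero[OF char, of c] by simp
qed

text \<open>The characters see only supports, so they kill the difference of the two orbit sums.
  Hence the orbit sums are equal, and the one of \<open>b\<close> is nonzero at
  \<open>a\<close>.\<close>

lemma same_orbit_if_injective:
  fixes K :: "'k::field itself"
  assumes char: "\<not> CHAR('k) dvd Coset.order G"
    and inj: "\<And>f :: 'b \<Rightarrow> 'k. invariant f \<Longrightarrow> (\<And>c. support_char c f = 0) \<Longrightarrow> f = (\<lambda>_. 0)"
    and supp: "supp a = supp b"
  shows "orbit G \<phi> a = orbit G \<phi> b"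
proof -
  define f where "f = (\<lambda>d. orbit_sum a d - orbit_sum b d :: 'k)"
  have "invariant f"
    using invariant_orbit_sum[where 'k = 'k] by (simp add: f_def invariant_def)
  moreover have "support_char c f = 0" for c
  proof -
    have "c * \<phi> g a = c \<longleftrightarrow> c * \<phi> g b = c" if "g \<in> carrier G" for g
      using supp supp_action[OF that] by (metis supp_subset_iff)
    then show ?thesis
      by (simp add: f_def support_char_diff support_char_orbit_sum cong: conj_cong)
  qed
  ultimately have "f = (\<lambda>_. 0)" by (rule inj)
  then have "orbit_sum b a = (orbit_sum a a :: 'k)"
    by (simp add: f_def fun_eq_iff)
  then have "{g\<in>carrier G. \<phi> g b = a} \<noteq> {}"
    using orbit_sum_self_nonzero[OF char, of a] by (metis card.empty of_nat_0 orbit_sum_eq)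
  then show ?thesis
    using orbit_eq_iff by blast
qed

text \<open>Testing with the orbit sums of \<open>a\<close> and \<open>b\<close> gives a translate
  of each support above the other one; comparing sizes turns the inclusions into equalities.\<close>

lemma same_support_orbit_if_support_char_eq:
  assumes char: "\<not> CHAR('k::field) dvd Coset.order G"
    and eq: "\<And>f :: 'b \<Rightarrow> 'k. invariant f \<Longrightarrow> support_char a f = support_char b f"
  shows "orbit G (support_action \<phi>) (supp a) = orbit G (support_action \<phi>) (supp b)"
proof -
  have *: "\<exists>g\<in>carrier G. d * \<phi> g c = d"
    if "support_char c (orbit_sum c) = support_char d (orbit_sum c :: 'b \<Rightarrow> 'k)" for c d
  proof -
    have "{g\<in>carrier G. d * \<phi> g c = d} \<noteq> {}"
      using support_char_orbit_sum_self_nonzero[OF char, of c] that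
      by (metis card.empty of_nat_0 support_char_orbit_sum)
    then show ?thesis by blast
  qed
  obtain g where g: "g \<in> carrier G" "a * \<phi> g b = a"
    using *[of b a] eq[OF invariant_orbit_sum] by metis
  obtain h where h: "h \<in> carrier G" "b * \<phi> h a = b"
    using *[of a b] eq[OF invariant_orbit_sum] by metis
  have "card (supp b) \<le> card (supp (\<phi> h a))"
    using h(2) by (intro card_mono) (simp_all add: supp_subset_iff)
  then have "supp (\<phi> g b) = supp a"
    using g h(1) by (intro supp_eq_if_card) (simp_all add: card_supp_action)
  then show ?thesis
    using g(1) orbit_support_eq_iff by metis
qed

section \<open>The eigenvalue polynomial\<close>

lemma count_above_action:
  assumes "g \<in> carrier G" "\<phi> g ` S = S"
  shows "count_above S (supp (\<phi> g c)) = count_above S (supp c)"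
proof -
  have "{b\<in>S. \<phi> g c * b = \<phi> g c} = \<phi> g ` {b\<in>S. c * b = c}"
  proof (intro equalityI subsetI)
    fix a assume a: "a \<in> {b\<in>S. \<phi> g c * b = \<phi> g c}"
    then obtain b where "b \<in> S" "a = \<phi> g b" using assms(2) by blast
    then show "a \<in> \<phi> g ` {b\<in>S. c * b = c}"
      using a assms(1) by (simp flip: action_mult)
  qed (use assms in \<open>auto simp flip: action_mult\<close>)
  then show ?thesis
    using assms(1) by (simp add: count_above_def supp_subset_iff card_image inj_on_def)
qed

text \<open>Invariance of \<open>S\<close> gives \<open>the_elem\<close> a singleton on each orbit,
  and \<open>sep\<close> makes the roots for different orbits distinct, so divisibility amounts to
  vanishing at the roots.\<close>

lemma eigenvalue_poly_dvd_iff: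
  fixes p :: "'k::field poly"
  assumes S: "\<And>g. g \<in> carrier G \<Longrightarrow> \<phi> g ` S = S"
    and sep: "\<And>a b. of_nat (count_above S (supp a)) = (of_nat (count_above S (supp b)) :: 'k)
      \<Longrightarrow> orbit G (support_action \<phi>) (supp a) = orbit G (support_action \<phi>) (supp b)"
  shows "eigenvalue_poly G \<phi> S dvd p \<longleftrightarrow> (\<forall>c. poly p (of_nat (count_above S (supp c))) = 0)"
proof -
  let ?l = "\<lambda>C. of_nat (the_elem (count_above S ` C)) :: 'k"
  have "count_above S ` orbit G (support_action \<phi>) (supp c) = {count_above S (supp c)}" for c
    unfolding orbit_support image_image using S orbit_refl[of c]
    by (auto simp: orbit_def count_above_action)
  then have l: "?l (orbit G (support_action \<phi>) (supp c)) = of_nat (count_above S (supp c))" for c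
    by simp
  have orbits: "orbits G supports (support_action \<phi>)
      = range (\<lambda>c. orbit G (support_action \<phi>) (supp c))"
    by (auto simp: orbits_def supports_def)
  have "inj_on ?l (orbits G supports (support_action \<phi>))"
  proof (rule inj_onI)
    fix C D
    assume "C \<in> orbits G supports (support_action \<phi>)" "D \<in> orbits G supports (support_action \<phi>)"
      and eq: "?l C = ?l D"
    then obtain a b where "C = orbit G (support_action \<phi>) (supp a)"
      "D = orbit G (support_action \<phi>) (supp b)"
      unfolding orbits by blast
    then show "C = D" using eq sep[of a b] by (simp only: l)
  qed
  then show ?thesis
    unfolding eigenvalue_poly_def
    by (subst prod_linear_dvd_iff) (simp_all add: orbits l)
qed

end

section \<open>The equivalence and the presentation by one generator\<close>

theorem theorem4p10:
  fixes G :: "('g, 'm) monoid_scheme"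
    and \<phi> :: "'g \<Rightarrow> 'b::left_regular_band \<Rightarrow> 'b"
    and \<O> :: "'b set"
    and x :: "'b \<Rightarrow> 'k::field"
  assumes "connected_lrb TYPE('b)"
    and "finite (carrier G)"
    and "group_action G UNIV \<phi>"
    and "\<And>g a b. g \<in> carrier G \<Longrightarrow> \<phi> g (a * b) = \<phi> g a * \<phi> g b"
    and "\<not> CHAR('k) dvd Coset.order G"
    and "\<And>g. g \<in> carrier G \<Longrightarrow> \<phi> g ` \<O> = \<O>"
    and "x = sum_elt \<O>"
  shows "(generated_subalgebra (invariant_algebra G \<phi>) {x} = carrier (invariant_algebra G \<phi>)
      \<longleftrightarrow>
        card (orbits G UNIV \<phi>) = card (orbits G supports (support_action \<phi>)) \<and>
        (\<forall>U\<in>supports. \<forall>V\<in>supports.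
          [count_above \<O> U = count_above \<O> V] (mod CHAR('k)) \<longrightarrow>
          orbit G (support_action \<phi>) U = orbit G (support_action \<phi>) V))
    \<and> (generated_subalgebra (invariant_algebra G \<phi>) {x} = carrier (invariant_algebra G \<phi>)
      \<longrightarrow>
        algebras_isomorphic (invariant_algebra G \<phi>)
          (quotient_algebra poly_algebra
            (PIdl\<^bsub>poly_algebra\<^esub> (eigenvalue_poly G \<phi> \<O> :: 'k poly))))"
proof -
  interpret lrb_action G \<phi>
    using assms(2-4) by (intro lrb_action.intro lrb_action_axioms.intro)
  interpret A: unital_algebra "invariant_algebra G \<phi> :: ('k, 'b \<Rightarrow> 'k) module"
    by (rule unital_algebra_invariant[OF assms(1)])
  note char = assms(5)
  define lam where "lam c = (of_nat (count_above \<O> (supp c)) :: 'k)" for c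
  have lam: "support_char c x = lam c" for c
    by (simp add: assms(7) support_char_sum_elt lam_def)
  have "invariant x"
  proof -
    have x: "x a = (if a \<in> \<O> then 1 else 0)" for a
      by (simp add: assms(7) sum_elt_apply)
    have "\<phi> g b \<in> \<O> \<longleftrightarrow> b \<in> \<O>" if "g \<in> carrier G" for g b
      using assms(6)[OF that] that by (metis action_eq_iff image_iff)
    then show ?thesis by (simp add: invariant_def x)
  qed
  then have x: "x \<in> carrier (invariant_algebra G \<phi>)"
    by (simp add: carrier_invariant_algebra)
  note generated = A.generated_subalgebra_singleton[OF x]
  let ?ev = "A.poly_eval x"
  have ev: "invariant (?ev p)" for p
    using A.poly_eval_closed[OF x, of p] by (simp add: carrier_invariant_algebra)
  \<comment> \<open>The identity is in general no basis element, so its character is found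
    indirectly: by multiplicativity it fixes the nonzero value at an orbit sum.\<close>
  have one: "support_char c \<one>\<^bsub>invariant_algebra G \<phi>\<^esub> = (1 :: 'k)" for c
  proof -
    have "support_char c \<one>\<^bsub>invariant_algebra G \<phi>\<^esub> * support_char c (orbit_sum c)
        = support_char c (orbit_sum c :: 'b \<Rightarrow> 'k)"
      by (simp add: invariant_one[OF assms(1)] flip: support_char_convolution)
    then show ?thesis
      using support_char_orbit_sum_self_nonzero[OF char, of c] by simp
  qed
  have char_ev: "support_char c (?ev p) = poly p (lam c)" for c p
    by (induction p)
      (simp_all add: A.poly_eval_pCons[OF x] support_char_add support_char_smult
        support_char_convolution one lam)
  \<comment> \<open>The two halves of condition (2) are treated apart: \<open>separated\<close> is
    the congruence condition, and \<open>injective\<close> will turn out to be the equality of the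
    numbers of orbits.\<close>
  define separated where "separated \<longleftrightarrow> (\<forall>a b. lam a = lam b \<longrightarrow>
    orbit G (support_action \<phi>) (supp a) = orbit G (support_action \<phi>) (supp b))"
  define injective where "injective \<longleftrightarrow>
    (\<forall>f :: 'b \<Rightarrow> 'k. invariant f \<longrightarrow> (\<forall>c. support_char c f = 0) \<longrightarrow> f = (\<lambda>_. 0))"
  \<comment> \<open>Congruence modulo the characteristic is equality of the images in the field,
    also in characteristic 0.\<close>
  have sep_iff: "separated \<longleftrightarrow> (\<forall>U\<in>supports. \<forall>V\<in>supports.
      [count_above \<O> U = count_above \<O> V] (mod CHAR('k)) \<longrightarrow>
      orbit G (support_action \<phi>) U = orbit G (support_action \<phi>) V)"
    by (simp add: separated_def supports_def lam_def of_nat_eq_iff_cong_CHAR)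
  have necessary: "injective \<and> separated" if gen: "range ?ev = Collect invariant"
  proof
    show injective
      unfolding injective_def
    proof (intro allI impI)
      fix f :: "'b \<Rightarrow> 'k" assume f: "invariant f" "\<forall>c. support_char c f = 0"
      \<comment> \<open>Polynomials in a single element commute, which supplies the commutativity
        needed for injectivity.\<close>
      have "convolution f h = convolution h f" if "invariant h" for h
      proof -
        obtain p q where "f = ?ev p" "h = ?ev q" using gen f(1) \<open>invariant h\<close> by blast
        then show ?thesis using A.poly_eval_commute[OF x, of p q] by simp
      qed
      then show "f = (\<lambda>_. 0)"
        using f(2) by (intro support_chars_injective_if_commutative[OF char]) auto
    qed
    show separated
      unfolding separated_def
    proof (intro allI impI)
      fix a b assume ab: "lam a = lam b"
      show "orbit G (support_action \<phi>) (supp a) = orbit G (support_action \<phi>) (supp b)"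
      proof (rule same_support_orbit_if_support_char_eq[OF char])
        fix f :: "'b \<Rightarrow> 'k" assume "invariant f"
        then obtain p where "f = ?ev p" using gen by blast
        then show "support_char a f = support_char b f" by (simp add: char_ev ab)
      qed
    qed
  qed
  have sufficient: "range ?ev = Collect invariant" if injective separated
  proof (intro equalityI subsetI)
    fix f :: "'b \<Rightarrow> 'k" assume "f \<in> Collect invariant"
    then have f: "invariant f" by simp
    have char_f: "support_char a f = support_char b f" if ab: "lam a = lam b" for a b
    proof -
      obtain g where "g \<in> carrier G" "supp a = supp (\<phi> g b)"
        using ab \<open>separated\<close> orbit_support_eq_iff unfolding separated_def by metis
      then show ?thesis
        using support_char_invariant[OF f] support_char_cong by metis
    qed
    \<comment> \<open>The nodes \<open>lam c\<close> run over all elements and may repeat;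
      \<open>char_f\<close> ensures that the prescribed values agree then.\<close>
    have "\<exists>p. \<forall>c\<in>UNIV. poly p (lam c) = support_char c f"
      by (rule interpolation_poly[OF finite]) (rule char_f)
    then obtain p where p: "poly p (lam c) = support_char c f" for c
      by blast
    have "invariant (\<lambda>b. ?ev p b - f b)"
      using f ev[of p] by (simp add: invariant_def)
    moreover have "support_char c (\<lambda>b. ?ev p b - f b) = 0" for c
      by (simp add: support_char_diff char_ev p)
    ultimately have "(\<lambda>b. ?ev p b - f b) = (\<lambda>_. 0)"
      using \<open>injective\<close> unfolding injective_def by blast
    then have "f = ?ev p" by (simp add: fun_eq_iff)
    then show "f \<in> range ?ev" by blast
  qed (use ev in auto)
  have injective_iff: "injective
      \<longleftrightarrow> card (orbits G UNIV \<phi>) = card (orbits G supports (support_action \<phi>))"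
    unfolding card_orbits_eq_iff
  proof
    assume injective
    then have inj: "f = (\<lambda>_. 0)" if "invariant f" "\<And>c. support_char c f = 0" for f :: "'b \<Rightarrow> 'k"
      using that unfolding injective_def by blast
    show "\<forall>a b. supp a = supp b \<longrightarrow> orbit G \<phi> a = orbit G \<phi> b"
      using same_orbit_if_injective[OF char inj] by blast
  next
    assume orb: "\<forall>a b. supp a = supp b \<longrightarrow> orbit G \<phi> a = orbit G \<phi> b"
    show injective
      unfolding injective_def
    proof (intro allI impI)
      fix f :: "'b \<Rightarrow> 'k" assume "invariant f" "\<forall>c. support_char c f = 0"
      then show "f = (\<lambda>_. 0)"
        using orb by (intro support_chars_injective_if_orbits[OF char]) blast+
    qed
  qed
  have "algebras_isomorphic (invariant_algebra G \<phi>)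
      (quotient_algebra poly_algebra (PIdl\<^bsub>poly_algebra\<^esub> (eigenvalue_poly G \<phi> \<O> :: 'k poly)))"
    if gen: "range ?ev = Collect invariant"
  proof (rule A.quotient_algebra_isomorphic[OF x])
    show "range ?ev = carrier (invariant_algebra G \<phi>)"
      by (simp add: gen carrier_invariant_algebra)
    fix p
    \<comment> \<open>The kernel of evaluation: the characters of \<open>?ev p\<close> are the
      values of \<open>p\<close> at the eigenvalues, and by injectivity they all vanish only if
      \<open>?ev p\<close> does.\<close>
    have "eigenvalue_poly G \<phi> \<O> dvd p \<longleftrightarrow> (\<forall>c. support_char c (?ev p) = 0)"
      unfolding char_ev lam_def
    proof (rule eigenvalue_poly_dvd_iff)
      show "orbit G (support_action \<phi>) (supp a) = orbit G (support_action \<phi>) (supp b)"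
        if "of_nat (count_above \<O> (supp a)) = (of_nat (count_above \<O> (supp b)) :: 'k)" for a b
        using that necessary[OF gen] unfolding separated_def lam_def by blast
    qed (rule assms(6))
    also have "\<dots> \<longleftrightarrow> ?ev p = \<zero>\<^bsub>invariant_algebra G \<phi>\<^esub>"
    proof
      assume "\<forall>c. support_char c (?ev p) = 0"
      then have "?ev p = (\<lambda>_. 0)"
        using necessary[OF gen] ev[of p] unfolding injective_def by blast
      then show "?ev p = \<zero>\<^bsub>invariant_algebra G \<phi>\<^esub>" by simp
    qed simp
    finally show "?ev p = \<zero>\<^bsub>invariant_algebra G \<phi>\<^esub> \<longleftrightarrow> eigenvalue_poly G \<phi> \<O> dvd p" by simp
  qed
  then show ?thesis
    unfolding generated carrier_invariant_algebra
    using necessary sufficient injective_iff sep_iff by blast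
qed

end
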